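(* Let $G$ be a connected graph with $n$ vertices, $m$ edges, maximum degree $\Delta$ and cyclomatic number $c=m-n+1$ satisfying $1\le c\le \frac{n+2}{2}$. Then $$S(G)=\frac2n\sum_{i=3}^{\Delta}N_i(in-2m),\qquad \mathrm{Var}(G)=\frac1n\sum_{i=3}^{\Delta}N_i(i-1)(i-2)-\frac{2(2m-n)(m-n)}{n^2}.$$
   Context: $N_i$ is the number of vertices of degree $i$. With degrees $d_1,\dots,d_n$: $S(G)=\sum_i|d_i-\frac{2m}{n}|$, $\mathrm{Var}(G)=\frac1n\sum_i(d_i-\frac{2m}{n})^2$. *)

theory Defs
  imports Complex_Main "Graph_Theory.Digraph_Component"
begin

text \<open>A finite simple graph is represented as in \<^theory>\<open>Graph_Theory.Digraph\<close>, by
  the locale predicate \<open>graph\<close>: a finite, loop-free, symmetric digraph without parallel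
  arcs. Each undirected edge is then a pair of opposite arcs; \<open>edges\<close> identifies the two,
  so that its cardinality is the number of edges of the undirected graph.\<close>

definition edges :: "('a, 'b) pre_digraph \<Rightarrow> 'a set set" where
  "edges G = (\<lambda>a. {tail G a, head G a}) ` arcs G"

text \<open>In a graph in the above sense, every edge at \<open>v\<close> contributes exactly one arc with
  tail \<open>v\<close>, so that \<open>out_degree\<close> (which equals \<open>in_degree\<close>) is the degree of the
  undirected graph.\<close>

abbreviation degree :: "('a, 'b) pre_digraph \<Rightarrow> 'a \<Rightarrow> nat" where
  "degree G v \<equiv> out_degree G v"

definition max_degree :: "('a, 'b) pre_digraph \<Rightarrow> nat" where
  "max_degree G = Max (degree G ` verts G)"

definition num_verts_of_degree :: "('a, 'b) pre_digraph \<Rightarrow> nat \<Rightarrow> nat" where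
  "num_verts_of_degree G i = card {v \<in> verts G. degree G v = i}"

text \<open>This is the cyclomatic number of a connected graph only.\<close>

definition cyclomatic_number :: "('a, 'b) pre_digraph \<Rightarrow> int" where
  "cyclomatic_number G = int (card (edges G)) - int (card (verts G)) + 1"

definition average_degree :: "('a, 'b) pre_digraph \<Rightarrow> real" where
  "average_degree G = 2 * real (card (edges G)) / real (card (verts G))"

definition degree_deviation :: "('a, 'b) pre_digraph \<Rightarrow> real" where
  "degree_deviation G = (\<Sum>v\<in>verts G. \<bar>real (degree G v) - average_degree G\<bar>)"

definition degree_variance :: "('a, 'b) pre_digraph \<Rightarrow> real" where
  "degree_variance G =
     1 / real (card (verts G)) * (\<Sum>v\<in>verts G. (real (degree G v) - average_degree G)\<^sup>2)"

end

theory Submission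
  imports Defs
begin

text \<open>The hypothesis on \<open>c\<close> says exactly that the average degree \<open>2m/n\<close> lies between 2 and 3,
  so the terms of the deviation that are positive come from vertices of degree at least 3, and
  since the deviations sum to zero by the handshake lemma, \<open>S(G)\<close> is twice the sum of these.
  For the variance, the handshake lemma turns \<open>\<Sum> d\<^sup>2\<close> into \<open>\<Sum> (d - 1)(d - 2)\<close>, in
  which degrees 1 and 2 contribute nothing, while degree 0 is excluded by connectedness.\<close>

lemma (in fin_digraph) sum_out_degree: "(\<Sum>v\<in>verts G. out_degree G v) = card (arcs G)"
proof -
  have "card (arcs G) = (\<Sum>v\<in>verts G. card {e \<in> arcs G. tail G e = v})"
    using sum.group[of "arcs G" "verts G" "tail G" "\<lambda>_. 1::nat"] by (simp add: image_subset_iff)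
  then show ?thesis
    by (simp add: out_degree_def out_arcs_def)
qed

text \<open>Every fibre of the map from arcs to end sets is an arc with its reverse: symmetry
  supplies the reverse, the absence of loops makes the two distinct, and the absence of parallel
  arcs excludes a third.\<close>

lemma (in graph) card_arcs_eq: "card (arcs G) = 2 * card (edges G)"
proof -
  let ?ends = "\<lambda>e. {tail G e, head G e}"
  have "card {b \<in> arcs G. ?ends b = x} = 2" if x: "x \<in> edges G" for x
  proof -
    obtain a where a: "a \<in> arcs G" "x = ?ends a"
      using x by (auto simp: edges_def)
    obtain a' where a': "a' \<in> arcs G" "tail G a = head G a'" "head G a = tail G a'"
      using sym_arcs a by (auto simp: symmetric_conv)
    have "{b \<in> arcs G. ?ends b = x} = {a, a'}"
    proof (intro equalityI subsetI)
      fix b assume "b \<in> {b \<in> arcs G. ?ends b = x}"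
      then have b: "b \<in> arcs G" "?ends b = ?ends a"
        using a by auto
      from b(2) have "arc_to_ends G b = arc_to_ends G a \<or> arc_to_ends G b = arc_to_ends G a'"
        using a' by (auto simp: arc_to_ends_def doubleton_eq_iff)
      then show "b \<in> {a, a'}"
        using no_multi_arcs b(1) a(1) a'(1) by blast
    qed (use a a' in auto)
    moreover have "a \<noteq> a'"
      using no_loops[OF a(1)] a' by auto
    ultimately show ?thesis
      by simp
  qed
  then show ?thesis
    using sum.group[of "arcs G" "edges G" ?ends "\<lambda>_. 1::nat"] by (simp add: edges_def)
qed

lemma (in graph) handshake: "(\<Sum>v\<in>verts G. degree G v) = 2 * card (edges G)"
  by (simp add: sum_out_degree card_arcs_eq)

text \<open>A walk from \<open>v\<close> to a different vertex has to leave \<open>v\<close> by some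
  arc. A single isolated vertex is connected with degree 0, hence the second assumption.\<close>

lemma (in graph) degree_pos_if_connected:
  assumes "connected G" and "card (verts G) \<noteq> 1" and "v \<in> verts G"
  shows "degree G v > 0"
proof -
  have "verts G \<noteq> {v}"
    using assms(2) by auto
  then obtain u where u: "u \<in> verts G" "u \<noteq> v"
    using assms(3) by auto
  \<comment> \<open>For digraphs \<open>connected\<close> disregards orientation; symmetry of the
    arcs turns it into directed reachability.\<close>
  have "v \<rightarrow>\<^sup>*\<^bsub>G\<^esub> u"
    using symmetric_connected_imp_strongly_connected[OF sym_arcs assms(1)] u(1) assms(3)
    by (auto simp: strongly_connected_def)
  then obtain w where "v \<rightarrow>\<^bsub>G\<^esub> w"
    using u(2) by (cases rule: converse_reachable_cases) auto
  then have "out_arcs G v \<noteq> {}"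
    by (auto simp: arcs_ends_conv)
  then show ?thesis
    using finite_out_arcs by (simp add: out_degree_def card_gt_0_iff)
qed

text \<open>Groups the vertices by degree. With \<open>k = 3\<close> it converts both sums of the
  theorem into sums over vertices.\<close>

lemma (in fin_digraph) sum_num_verts_of_degree:
  fixes f :: "nat \<Rightarrow> 'c::semiring_1"
  shows "(\<Sum>i=k..max_degree G. of_nat (num_verts_of_degree G i) * f i) =
    (\<Sum>v\<in>verts G. if k \<le> degree G v then f (degree G v) else 0)"
proof -
  let ?A = "{v \<in> verts G. k \<le> degree G v}"
  have "degree G ` ?A \<subseteq> {k..max_degree G}"
    by (auto simp: max_degree_def)
  then have "(\<Sum>v\<in>?A. f (degree G v)) =
      (\<Sum>i=k..max_degree G. \<Sum>v\<in>{v \<in> ?A. degree G v = i}. f (degree G v))"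
    by (intro sum.group[symmetric]) auto
  also have "\<dots> = (\<Sum>i=k..max_degree G. of_nat (num_verts_of_degree G i) * f i)"
  proof (rule sum.cong)
    fix i assume "i \<in> {k..max_degree G}"
    then have "{v \<in> ?A. degree G v = i} = {v \<in> verts G. degree G v = i}"
      by auto
    then show "(\<Sum>v\<in>{v \<in> ?A. degree G v = i}. f (degree G v)) =
        of_nat (num_verts_of_degree G i) * f i"
      by (simp add: num_verts_of_degree_def)
  qed simp
  finally show ?thesis
    by (simp add: sum.inter_filter)
qed

text \<open>Serves to exclude the one-vertex graph, where the degree is 0, once m \<ge> n is
  known.\<close>

lemma (in graph) card_edges_zero_if_card_verts_one:
  assumes "card (verts G) = 1"
  shows "card (edges G) = 0"
proof -
  obtain v where "verts G = {v}"
    using assms by (auto simp: card_1_singleton_iff)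
  then have "arcs G = {}"
    using no_loops tail_in_verts head_in_verts by fastforce
  then show ?thesis
    by (simp add: edges_def)
qed

lemma (in graph) degree_deviation_eq:
  assumes "2 \<le> average_degree G" and "average_degree G \<le> 3"
  shows "degree_deviation G = 2 * (\<Sum>i=3..max_degree G.
    real (num_verts_of_degree G i) * (real i - average_degree G))"
proof -
  let ?a = "average_degree G"
  let ?excess = "\<lambda>v. if 3 \<le> degree G v then real (degree G v) - ?a else 0"
  have "(\<Sum>v\<in>verts G. real (degree G v) - ?a) = 0"
    using handshake
    by (auto simp: sum_subtractf average_degree_def simp flip: of_nat_sum)
  \<comment> \<open>This is |x| = 2 max(x, 0) - x. As \<open>?a\<close> lies in [2, 3] and degrees
    are integers, \<open>?excess\<close> is the positive part: degrees from 3 on are at least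
    \<open>?a\<close>, all others at most \<open>?a\<close>.\<close>
  moreover have "\<bar>real (degree G v) - ?a\<bar> = 2 * ?excess v - (real (degree G v) - ?a)" for v
  proof (cases "3 \<le> degree G v")
    case False
    then have "real (degree G v) \<le> 2"
      by linarith
    with False assms show ?thesis
      by simp
  qed (use assms in auto)
  ultimately have "degree_deviation G = 2 * (\<Sum>v\<in>verts G. ?excess v)"
    by (simp add: degree_deviation_def sum_subtractf flip: sum_distrib_left)
  then show ?thesis
    using sum_num_verts_of_degree[where k = 3 and f = "\<lambda>i. real i - ?a"] by simp
qed

lemma (in graph) degree_variance_eq:
  assumes "\<And>v. v \<in> verts G \<Longrightarrow> degree G v > 0" and "verts G \<noteq> {}"
  shows "degree_variance G = 1 / real (card (verts G)) * (\<Sum>i=3..max_degree G.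
      real (num_verts_of_degree G i) * (real i - 1) * (real i - 2))
    - (average_degree G - 1) * (average_degree G - 2)"
proof -
  let ?a = "average_degree G" and ?n = "real (card (verts G))"
  let ?f = "\<lambda>i. (real i - 1) * (real i - 2)"
  have n: "?n \<noteq> 0"
    using assms(2) by simp
  have deg: "(\<Sum>v\<in>verts G. real (degree G v)) = ?a * ?n"
    using handshake n by (simp add: average_degree_def flip: of_nat_sum)
  \<comment> \<open>The coefficients come from expanding (d - a)^2 in terms of (d - 1)(d - 2), d and
    1. Since the degrees sum to a n, the last two terms add up to n ((3 - 2a) a + a^2 - 2) = -n (a -
    1)(a - 2).\<close>
  have "(\<Sum>v\<in>verts G. (real (degree G v) - ?a)\<^sup>2) =
      (\<Sum>v\<in>verts G. ?f (degree G v) + (3 - 2 * ?a) * real (degree G v) + (?a\<^sup>2 - 2))"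
    by (rule sum.cong) (auto simp: power2_eq_square algebra_simps)
  also have "\<dots> = (\<Sum>v\<in>verts G. ?f (degree G v)) + (3 - 2 * ?a) * (?a * ?n) + ?n * (?a\<^sup>2 - 2)"
    by (simp add: sum.distrib deg flip: sum_distrib_left)
  also have "\<dots> = (\<Sum>v\<in>verts G. ?f (degree G v)) - ?n * ((?a - 1) * (?a - 2))"
    by (simp add: power2_eq_square algebra_simps)
  also have "(\<Sum>v\<in>verts G. ?f (degree G v)) =
      (\<Sum>v\<in>verts G. if 3 \<le> degree G v then ?f (degree G v) else 0)"
  proof (rule sum.cong)
    fix v assume "v \<in> verts G"
    \<comment> \<open>A vertex of degree 0 would contribute (0 - 1)(0 - 2) = 2.\<close>
    then have "degree G v = 1 \<or> degree G v = 2 \<or> 3 \<le> degree G v"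
      using assms(1)[of v] by linarith
    then show "?f (degree G v) = (if 3 \<le> degree G v then ?f (degree G v) else 0)"
      by auto
  qed simp
  finally show ?thesis
    using n sum_num_verts_of_degree[where k = 3 and f = ?f]
    by (simp add: degree_variance_def mult.assoc diff_divide_distrib)
qed

theorem theorem27:
  fixes G :: "('a, 'b) pre_digraph" and n m \<Delta> :: nat and c :: int
  assumes "graph G" and "connected G"
    and "n = card (verts G)" and "m = card (edges G)"
    and "\<Delta> = max_degree G" and "c = cyclomatic_number G"
    and "1 \<le> c" and "real_of_int c \<le> (real n + 2) / 2"
  shows "degree_deviation G =
           2 / real n * (\<Sum>i=3..\<Delta>. real (num_verts_of_degree G i) * (real i * real n - 2 * real m))
         \<and> degree_variance G =
           1 / real n * (\<Sum>i=3..\<Delta>. real (num_verts_of_degree G i) * (real i - 1) * (real i - 2))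
             - 2 * (2 * real m - real n) * (real m - real n) / (real n)\<^sup>2"
proof -
  interpret graph G by fact
  have nonempty: "verts G \<noteq> {}"
    using assms(2) by (simp add: connected_conv)
  then have n: "real n > 0"
    using assms(3) by (simp add: card_gt_0_iff)
  have c: "real_of_int c = real m - real n + 1"
    using assms(3,4,6) by (simp add: cyclomatic_number_def)
  have avg: "average_degree G = 2 * real m / real n"
    using assms(3,4) by (simp add: average_degree_def)
  have "real_of_int c \<ge> 1"
    using assms(7) by simp
  \<comment> \<open>With c = m - n + 1, the lower bound on c gives the first inequality and the
    upper bound the second; divided by n they put the average degree between 2 and 3.\<close>
  then have mn: "real n \<le> real m" "2 * real m \<le> 3 * real n"
    using c assms(8) by (simp_all add: field_simps)
  have "n \<noteq> 1"
    using card_edges_zero_if_card_verts_one mn(1) assms(3,4) by auto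
  then have pos: "degree G v > 0" if "v \<in> verts G" for v
    using degree_pos_if_connected[OF assms(2)] that assms(3) by simp
  have "degree_deviation G =
      2 * (\<Sum>i=3..\<Delta>. real (num_verts_of_degree G i) * (real i - 2 * real m / real n))"
    using degree_deviation_eq n mn by (simp add: avg assms(5) field_simps)
  also have "\<dots> =
      2 / real n * (\<Sum>i=3..\<Delta>. real (num_verts_of_degree G i) * (real i * real n - 2 * real m))"
    using n by (auto simp: sum_distrib_left field_simps intro!: sum.cong)
  finally have "degree_deviation G = \<dots>" .
  \<comment> \<open>The factors are (2m - n)/n and 2(m - n)/n.\<close>
  moreover have "(average_degree G - 1) * (average_degree G - 2) =
      2 * (2 * real m - real n) * (real m - real n) / (real n)\<^sup>2"
    using n by (simp add: avg field_simps power2_eq_square)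
  ultimately show ?thesis
    using degree_variance_eq[OF pos nonempty] assms(3,5) by simp
qed

end
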